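(* Let $N\in\mathbb{N}$, let $I$ be an interval of $\mathbb{R}$, and let $A=[a_1\cdots a_N]:I\to M_N(\mathbb{R})$ be a continuous function, where $a_1(t),\ldots,a_N(t)$ are the columns of $A(t)$, such that the following hold: (i) for all $t\in I$ we have $\|A(t)\|\leq 1$; and (ii) $\theta=\inf_{t\in I}\min_{1\leq i\leq N}\|a_i(t)\|>0$. Then for every $n\in\mathbb{N}$ with $1\leq n\leq \frac{1}{12}\theta^{4/3}N^{1/3}$ there exist continuous functions $L:I\to M_{n\times N}(\mathbb{R})$ and $R:I\to M_{N\times n}(\mathbb{R})$ such that for all $t\in I$ we have $L(t)A(t)R(t)=I_n$ and $\|L(t)\|\|R(t)\|\leq 2/\theta$.
   Context: $\mathbb{N}=\{1,2,\ldots\}$. $M_{m\times k}(\mathbb{R})$ is the set of real $m\times k$ matrices and $M_N(\mathbb{R})=M_{N\times N}(\mathbb{R})$. A matrix function is continuous if all its entries are continuous scalar functions. For a vector $x\in\mathbb{R}^k$, $\|x\|$ is the Euclidean norm. For a real $m\times k$ matrix $B$, $\|B\|=\sup\{\|Bx\|:x\in\mathbb{R}^k,\ \|x\|\leq 1\}$ is the Euclidean operator norm. $I_n$ is the $n\times n$ identity matrix. *)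

theory Defs
  imports "HOL-Analysis.Analysis"
begin

end

theory Submission
  imports Defs
begin

text \<open>
  Since \<open>\<parallel>A\<parallel> \<le> 1\<close>, the rows of the Gram matrix \<open>A\<^sup>T A\<close> have Euclidean norm at most \<open>1\<close>, so a column
  has inner product larger than \<open>\<epsilon>\<close> with at most \<open>1 / \<epsilon>\<^sup>2\<close> columns. For \<open>\<epsilon> = \<theta>\<^sup>2 / (8 n)\<close> a greedy
  choice therefore yields \<open>n\<close> columns that are nearly orthogonal to each other and to \<open>n\<close> previously
  chosen ones. On a short interval the Gram matrix is almost constant, and there \<open>R\<close> rotates the
  isometric coordinate embedding given by the old choice into the one given by the new choice; all
  the while \<open>A R\<close> is bounded below by \<open>\<theta> / 2\<close>. Chaining such steps covers \<open>I\<close>, and \<open>L\<close> is the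
  pseudoinverse of \<open>A R\<close>, of norm at most \<open>2 / \<theta>\<close>.
\<close>

section \<open>Nearly orthogonal columns\<close>

definition near_orth :: "real \<Rightarrow> real ^ 'k ^ 'm \<Rightarrow> 'k set \<Rightarrow> bool" where
  "near_orth \<eta> A S \<longleftrightarrow>
     (\<forall>k\<in>S. \<forall>l\<in>S. k \<noteq> l \<longrightarrow> \<bar>column k A \<bullet> column l A\<bar> \<le> \<eta>)"

text \<open>A Gershgorin-type estimate for the Gram form on vectors supported in \<open>S\<close>:
  the diagonal contributes \<theta> squared, and the off-diagonal terms are absorbed by the
  arithmetic-geometric inequality for \<open>y $ k * y $ l\<close>.\<close>

lemma norm_mult_lower_bound_near_orth:
  fixes A :: "real ^ 'k ^ 'm"
  assumes orth: "near_orth \<eta> A S" and "\<eta> \<ge> 0" and "\<theta> \<ge> 0"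
    and col: "\<And>k. k \<in> S \<Longrightarrow> \<theta> \<le> norm (column k A)"
    and supp: "\<And>k. k \<notin> S \<Longrightarrow> y $ k = 0"
  shows "(\<theta>\<^sup>2 - real (card S) * \<eta>) * (norm y)\<^sup>2 \<le> (norm (A *v y))\<^sup>2"
proof -
  have fin: "finite S" by simp
  have Ay: "A *v y = (\<Sum>k\<in>S. y $ k *\<^sub>R column k A)"
  proof -
    have "A *v y = (\<Sum>k\<in>UNIV. y $ k *\<^sub>R column k A)"
      by (simp add: matrix_mult_sum scalar_mult_eq_scaleR)
    also have "\<dots> = (\<Sum>k\<in>S. y $ k *\<^sub>R column k A)"
      by (rule sum.mono_neutral_right) (auto simp: supp)
    finally show ?thesis .
  qed
  have ny: "(norm y)\<^sup>2 = (\<Sum>k\<in>S. (y $ k)\<^sup>2)"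
  proof -
    have "(norm y)\<^sup>2 = (\<Sum>k\<in>UNIV. (y $ k)\<^sup>2)"
      by (simp add: norm_vec_def L2_set_def sum_nonneg)
    also have "\<dots> = (\<Sum>k\<in>S. (y $ k)\<^sup>2)"
      by (rule sum.mono_neutral_right) (auto simp: supp)
    finally show ?thesis .
  qed
  have "(norm (A *v y))\<^sup>2 =
      (\<Sum>k\<in>S. \<Sum>l\<in>S. (y $ k * y $ l) * (column k A \<bullet> column l A))"
    unfolding power2_norm_eq_inner Ay
    by (simp add: inner_sum_left inner_sum_right mult.assoc)
       (simp add: sum_distrib_left mult.assoc inner_commute)
  \<comment> \<open>The \<eta>-term is subtracted on the diagonal too; this only weakens the bound
    and lets the double sum collapse to \<open>real (card S) * \<eta>\<close> times the squared
    norm.\<close>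
  also have "\<dots> \<ge> (\<Sum>k\<in>S. \<Sum>l\<in>S.
      (if k = l then \<theta>\<^sup>2 * (y $ k)\<^sup>2 else 0) - \<eta> * ((y $ k)\<^sup>2 / 2 + (y $ l)\<^sup>2 / 2))"
  proof (intro sum_mono)
    fix k l assume kl: "k \<in> S" "l \<in> S"
    show "(if k = l then \<theta>\<^sup>2 * (y $ k)\<^sup>2 else 0) - \<eta> * ((y $ k)\<^sup>2 / 2 + (y $ l)\<^sup>2 / 2)
        \<le> (y $ k * y $ l) * (column k A \<bullet> column l A)"
    proof (cases "k = l")
      case True
      have "\<theta>\<^sup>2 \<le> column k A \<bullet> column k A"
        using col[OF kl(1)] \<open>\<theta> \<ge> 0\<close> by (simp add: power_mono flip: power2_norm_eq_inner)
      then have "\<theta>\<^sup>2 * (y $ k)\<^sup>2 \<le> (column k A \<bullet> column k A) * (y $ k)\<^sup>2"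
        by (intro mult_right_mono) auto
      moreover have "0 \<le> \<eta> * (y $ k)\<^sup>2" using \<open>\<eta> \<ge> 0\<close> by simp
      ultimately show ?thesis using True by (simp add: power2_eq_square mult_ac)
    next
      case False
      have "\<bar>(y $ k * y $ l) * (column k A \<bullet> column l A)\<bar> \<le> \<bar>y $ k * y $ l\<bar> * \<eta>"
        using orth kl False unfolding near_orth_def abs_mult
        by (intro mult_left_mono) auto
      also have "\<bar>y $ k * y $ l\<bar> \<le> (y $ k)\<^sup>2 / 2 + (y $ l)\<^sup>2 / 2"
        using sum_squares_bound[of "\<bar>y $ k\<bar>" "\<bar>y $ l\<bar>"] by (simp add: abs_mult)
      finally show ?thesis using False \<open>\<eta> \<ge> 0\<close>
        by (simp add: mult_right_mono mult.commute abs_le_iff)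
    qed
  qed
  also have "(\<Sum>k\<in>S. \<Sum>l\<in>S.
      (if k = l then \<theta>\<^sup>2 * (y $ k)\<^sup>2 else 0) - \<eta> * ((y $ k)\<^sup>2 / 2 + (y $ l)\<^sup>2 / 2))
      = (\<theta>\<^sup>2 - real (card S) * \<eta>) * (norm y)\<^sup>2"
    using fin unfolding ny
    by (simp add: sum_subtractf sum.distrib distrib_left flip: sum_distrib_left sum_divide_distrib)
       (simp add: algebra_simps)
  finally show ?thesis .
qed

text \<open>Moving the transpose across the inner product and applying Cauchy-Schwarz leaves one
  factor \<open>norm ?w\<close> to cancel. This carries the bound on \<open>A\<close> over to the
  rows of the Gram matrix.\<close>

lemma norm_transpose_mult_le:
  fixes A :: "real ^ 'k ^ 'm"
  assumes "\<And>x. norm (A *v x) \<le> norm x"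
  shows "norm (transpose A *v v) \<le> norm v"
proof -
  let ?w = "transpose A *v v"
  have "norm ?w * norm ?w = ?w \<bullet> ?w"
    by (metis power2_norm_eq_inner power2_eq_square)
  also have "\<dots> = v \<bullet> (A *v ?w)"
    by (simp add: dot_lmul_matrix flip: vector_transpose_matrix)
  also have "\<dots> \<le> norm v * norm ?w"
    by (metis assms norm_cauchy_schwarz mult_left_mono norm_ge_zero order_trans)
  finally show ?thesis
    by (metis linorder_not_le mult_right_le_imp_le norm_ge_zero order_le_less)
qed

text \<open>The inner products of column \<open>k\<close> with all columns are the coordinates of
  \<open>transpose A *v column k A\<close>, a vector of norm at most 1, so a Chebyshev count
  applies.\<close>

lemma card_correlated_columns:
  fixes A :: "real ^ 'k ^ 'm"
  assumes contr: "\<And>x. norm (A *v x) \<le> norm x" and "\<epsilon> > 0"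
  shows "real (card {l. \<epsilon> < \<bar>column k A \<bullet> column l A\<bar>}) \<le> 1 / \<epsilon>\<^sup>2"
proof -
  let ?X = "{l. \<epsilon> < \<bar>column k A \<bullet> column l A\<bar>}"
  have "real (card ?X) * \<epsilon>\<^sup>2 = (\<Sum>l\<in>?X. \<epsilon>\<^sup>2)" by simp
  also have "\<dots> \<le> (\<Sum>l\<in>?X. (column k A \<bullet> column l A)\<^sup>2)"
    using \<open>\<epsilon> > 0\<close> by (intro sum_mono) (auto simp: abs_le_square_iff[symmetric])
  also have "\<dots> \<le> (\<Sum>l\<in>UNIV. (column k A \<bullet> column l A)\<^sup>2)"
    by (intro sum_mono2) auto
  also have "\<dots> = (norm (transpose A *v column k A))\<^sup>2"
    by (simp add: norm_vec_def L2_set_def sum_nonneg matrix_vector_mult_def transpose_def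
        inner_vec_def column_def mult.commute)
  also have "\<dots> \<le> 1"
  proof -
    have "norm (column k A) \<le> 1"
      using contr[of "axis k 1"] by (simp add: norm_axis_1 matrix_vector_mult_basis)
    then show ?thesis
      using norm_transpose_mult_le[OF contr, of "column k A"] by (simp add: power_le_one)
  qed
  finally show ?thesis using \<open>\<epsilon> > 0\<close> by (simp add: field_simps)
qed

text \<open>Each index in \<open>F \<union> T\<close> forbids at most
  \<open>1 / \<epsilon>\<^sup>2\<close> columns, and by \<open>size\<close> the forbidden sets never
  exhaust the indices. The role of \<open>F\<close> is that of the choice currently in use, away
  from which the frame will be rotated.\<close>

lemma greedy_near_orth_columns:
  fixes A :: "real ^ 'k ^ 'm"
  assumes contr: "\<And>x. norm (A *v x) \<le> norm x" and "\<epsilon> > 0"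
    and diag: "\<And>k. \<epsilon> < (norm (column k A))\<^sup>2"
    and size: "real (card F + m) / \<epsilon>\<^sup>2 < real CARD('k)"
  shows "\<exists>T. card T = m \<and> T \<inter> F = {} \<and> near_orth \<epsilon> A T \<and>
           (\<forall>k\<in>F. \<forall>l\<in>T. \<bar>column k A \<bullet> column l A\<bar> \<le> \<epsilon>)"
  using size
proof (induction m)
  case 0
  show ?case by (intro exI[of _ "{}"]) (simp add: near_orth_def)
next
  case (Suc m)
  have "real (card F + m) / \<epsilon>\<^sup>2 \<le> real (card F + Suc m) / \<epsilon>\<^sup>2"
    by (intro divide_right_mono) auto
  with Suc obtain T where T: "card T = m" "T \<inter> F = {}" "near_orth \<epsilon> A T"
      "\<forall>k\<in>F. \<forall>l\<in>T. \<bar>column k A \<bullet> column l A\<bar> \<le> \<epsilon>"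
    by fastforce
  let ?X = "\<lambda>k. {l. \<epsilon> < \<bar>column k A \<bullet> column l A\<bar>}"
  have "real (card (\<Union>k\<in>F \<union> T. ?X k)) \<le> (\<Sum>k\<in>F \<union> T. real (card (?X k)))"
    using card_UN_le[of "F \<union> T" ?X] by (simp flip: of_nat_sum)
  also have "\<dots> \<le> (\<Sum>k\<in>F \<union> T. 1 / \<epsilon>\<^sup>2)"
    by (intro sum_mono card_correlated_columns contr \<open>\<epsilon> > 0\<close>)
  also have "\<dots> = real (card (F \<union> T)) / \<epsilon>\<^sup>2" by simp
  also have "\<dots> \<le> real (card F + Suc m) / \<epsilon>\<^sup>2"
    using card_Un_le[of F T] T(1) by (intro divide_right_mono) auto
  also have "\<dots> < real CARD('k)" by (fact Suc.prems)
  finally have "(\<Union>k\<in>F \<union> T. ?X k) \<noteq> UNIV" by auto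
  then obtain l where "l \<notin> (\<Union>k\<in>F \<union> T. ?X k)" by blast
  then have l: "\<bar>column k A \<bullet> column l A\<bar> \<le> \<epsilon>" if "k \<in> F \<union> T" for k
    using that by (auto simp: not_less)
  \<comment> \<open>By \<open>diag\<close> every index lies in its own forbidden set, so avoiding
    these sets already makes \<open>l\<close> new.\<close>
  have "l \<notin> F \<union> T"
    using l[of l] diag[of l] by (auto simp: power2_norm_eq_inner)
  with T l show ?case
    by (intro exI[of _ "insert l T"])
       (auto simp: near_orth_def inner_commute)
qed


section \<open>Coordinate embeddings and their rotations\<close>

text \<open>The columns of \<open>A ** coord_embed \<sigma>\<close> are the columns of
  \<open>A\<close> with indices \<open>\<sigma> j\<close>: a choice of columns, encoded as a matrix
  that can be deformed continuously.\<close>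

definition coord_embed :: "('n \<Rightarrow> 'k) \<Rightarrow> real ^ 'n ^ 'k" where
  "coord_embed \<sigma> = (\<chi> k j. if k = \<sigma> j then 1 else 0)"

lemma coord_embed_mult: "coord_embed \<sigma> *v x = (\<Sum>j\<in>UNIV. axis (\<sigma> j) (x $ j))"
  by (auto simp: vec_eq_iff coord_embed_def matrix_vector_mult_def axis_def intro!: sum.cong)

lemma coord_embed_mult_outside: "k \<notin> range \<sigma> \<Longrightarrow> (coord_embed \<sigma> *v x) $ k = 0"
  by (auto simp: coord_embed_def matrix_vector_mult_def intro!: sum.neutral)

lemma coord_embed_inner_embed:
  assumes "inj \<sigma>"
  shows "(coord_embed \<sigma> *v x) \<bullet> (coord_embed \<sigma> *v y) = x \<bullet> y"
proof -
  have "(coord_embed \<sigma> *v x) \<bullet> (coord_embed \<sigma> *v y) = (\<Sum>i\<in>UNIV. x $ i * y $ i)"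
    using assms
    by (simp add: coord_embed_mult inner_sum_left inner_sum_right inner_axis_axis inj_eq
        cong: if_cong)
  then show ?thesis by (simp add: inner_vec_def)
qed

lemma coord_embed_inner_disjoint:
  assumes "range \<sigma> \<inter> range \<tau> = {}"
  shows "(coord_embed \<sigma> *v x) \<bullet> (coord_embed \<tau> *v y) = 0"
proof -
  have "\<sigma> i \<noteq> \<tau> j" for i j using assms by blast
  then show ?thesis
    by (simp add: coord_embed_mult inner_sum_left inner_sum_right inner_axis_axis)
qed

text \<open>The rotation from \<open>coord_embed \<sigma>\<close> towards \<open>coord_embed \<tau>\<close> by the angle whose
  sine is \<open>sqrt s\<close>.\<close>

definition rotate_embed :: "('n \<Rightarrow> 'k) \<Rightarrow> ('n \<Rightarrow> 'k) \<Rightarrow> real \<Rightarrow> real ^ 'n ^ 'k" where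
  "rotate_embed \<sigma> \<tau> s = sqrt (1 - s) *\<^sub>R coord_embed \<sigma> + sqrt s *\<^sub>R coord_embed \<tau>"

lemma rotate_embed_mult:
  "rotate_embed \<sigma> \<tau> s *v x = sqrt (1 - s) *\<^sub>R (coord_embed \<sigma> *v x) + sqrt s *\<^sub>R (coord_embed \<tau> *v x)"
  by (simp add: rotate_embed_def matrix_vector_mult_add_rdistrib flip: scaleR_matrix_vector_assoc)

text \<open>Disjoint ranges give orthogonal images, so the cross terms vanish and the weights
  \<open>1 - s\<close> and \<open>s\<close> add up to 1.\<close>

lemma norm_rotate_embed_mult:
  assumes "inj \<sigma>" "inj \<tau>" "range \<sigma> \<inter> range \<tau> = {}" "0 \<le> s" "s \<le> 1"
  shows "norm (rotate_embed \<sigma> \<tau> s *v x) = norm x"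
proof -
  have "range \<tau> \<inter> range \<sigma> = {}" using assms by blast
  then have "(norm (rotate_embed \<sigma> \<tau> s *v x))\<^sup>2 = (norm x)\<^sup>2"
    using assms
    by (simp add: power2_norm_eq_inner rotate_embed_mult inner_add_left inner_add_right
        coord_embed_inner_embed coord_embed_inner_disjoint algebra_simps flip: power2_eq_square mult.assoc)
  then show ?thesis by simp
qed

text \<open>The isometry keeps the norm of \<open>R\<close> at most 1, and the lower bound gives
  \<open>A ** R\<close> a left inverse of norm at most \<open>1 / c\<close>; with
  \<open>c = \<theta> / 2\<close> the product is the desired \<open>2 / \<theta>\<close>.\<close>

definition stable_frame :: "real \<Rightarrow> real ^ 'k ^ 'm \<Rightarrow> real ^ 'n ^ 'k \<Rightarrow> bool" where
  "stable_frame c A R \<longleftrightarrow>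
     (\<forall>x. norm (R *v x) = norm x) \<and> (\<forall>x. c * norm x \<le> norm (A *v (R *v x)))"

text \<open>The near-orthogonality bound is applied to \<open>R *v x\<close>, which is supported in
  \<open>S\<close>. By \<open>small\<close> its constant is at least
  \<open>\<theta>\<^sup>2 / 4\<close>, the square of \<open>\<theta> / 2\<close>.\<close>

lemma stable_frameI:
  fixes A :: "real ^ 'k ^ 'm"
  assumes iso: "\<And>x. norm (R *v x) = norm x"
    and supp: "\<And>k x. k \<notin> S \<Longrightarrow> (R *v x) $ k = 0"
    and orth: "near_orth \<eta> A S" and "\<eta> \<ge> 0" and "\<theta> \<ge> 0"
    and col: "\<And>k. \<theta> \<le> norm (column k A)"
    and small: "4 * real (card S) * \<eta> \<le> 3 * \<theta>\<^sup>2"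
  shows "stable_frame (\<theta> / 2) A R"
  unfolding stable_frame_def
proof (intro conjI allI iso)
  fix x
  have "(\<theta> / 2 * norm x)\<^sup>2 = \<theta>\<^sup>2 / 4 * (norm (R *v x))\<^sup>2"
    by (simp add: iso power_mult_distrib power_divide)
  also have "\<dots> \<le> (\<theta>\<^sup>2 - real (card S) * \<eta>) * (norm (R *v x))\<^sup>2"
    using small by (intro mult_right_mono) auto
  also have "\<dots> \<le> (norm (A *v (R *v x)))\<^sup>2"
    using orth \<open>\<eta> \<ge> 0\<close> \<open>\<theta> \<ge> 0\<close> col supp by (rule norm_mult_lower_bound_near_orth)
  finally show "\<theta> / 2 * norm x \<le> norm (A *v (R *v x))"
    by (rule power2_le_imp_le) simp
qed


section \<open>Continuous frames\<close>

text \<open>As a locale, the setting can be interpreted a second time for the family reflected in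
  time.\<close>

locale contraction_family =
  fixes I :: "real set" and A :: "real \<Rightarrow> real ^ 'k ^ 'm" and \<theta> \<epsilon> :: real
  assumes interval: "is_interval I"
    and cont: "continuous_on I A"
    and contr: "\<And>t x. t \<in> I \<Longrightarrow> norm (A t *v x) \<le> norm x"
    and col: "\<And>t k. t \<in> I \<Longrightarrow> \<theta> \<le> norm (column k (A t))"
    and theta_pos: "\<theta> > 0"
    and eps_pos: "\<epsilon> > 0"
begin

text \<open>A fresh greedy choice has tolerance \<open>\<epsilon>\<close>; the drift of \<open>A\<close> over one short step costs another \<open>\<epsilon>\<close>.\<close>

definition state :: "real \<Rightarrow> ('n \<Rightarrow> 'k) \<Rightarrow> bool" where
  "state t \<sigma> \<longleftrightarrow> inj \<sigma> \<and> near_orth (2 * \<epsilon>) (A t) (range \<sigma>)"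

text \<open>Both ends are coordinate embeddings so that consecutive paths match where they meet;
  \<open>state b \<tau>\<close> is carried along because the next path starts from it.\<close>

definition frame_path ::
    "real \<Rightarrow> real \<Rightarrow> ('n \<Rightarrow> 'k) \<Rightarrow> (real \<Rightarrow> real ^ 'n ^ 'k) \<Rightarrow> ('n \<Rightarrow> 'k) \<Rightarrow> bool" where
  "frame_path a b \<sigma> R \<tau> \<longleftrightarrow> continuous_on {a..b} R \<and> R a = coord_embed \<sigma> \<and> R b = coord_embed \<tau> \<and>
     state b \<tau> \<and> (\<forall>t\<in>{a..b}. stable_frame (\<theta> / 2) (A t) (R t))"

lemma frame_path_join:
  assumes "frame_path a b \<sigma> R \<tau>" "frame_path b c \<tau> R' \<upsilon>" "a \<le> b" "b \<le> c"
  shows "frame_path a c \<sigma> (\<lambda>t. if t \<le> b then R t else R' t) \<upsilon>"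
proof -
  have "continuous_on ({a..b} \<union> {b..c}) (\<lambda>t. if t \<le> b then R t else R' t)"
    using assms by (intro continuous_on_cases) (auto simp: frame_path_def)
  moreover have "{a..b} \<union> {b..c} = {a..c}" using assms by auto
  ultimately show ?thesis using assms by (auto simp: frame_path_def)
qed

text \<open>The greedy choice with at most \<open>CARD('n)\<close> old and exactly
  \<open>CARD('n)\<close> new indices, whence the factor 2 in \<open>size\<close>. The set
  \<open>F\<close> is empty for the initial choice and \<open>range \<sigma>\<close> for a
  rotation.\<close>

lemma state_exists:
  assumes "t \<in> I" and size: "2 * real CARD('n::finite) / \<epsilon>\<^sup>2 < real CARD('k)"
    and diag: "\<epsilon> < \<theta>\<^sup>2" and "card F \<le> CARD('n::finite)"
  obtains \<tau> :: "'n::finite \<Rightarrow> 'k" where "inj \<tau>" "range \<tau> \<inter> F = {}" "near_orth \<epsilon> (A t) (range \<tau>)"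
    "\<And>k l. k \<in> F \<Longrightarrow> l \<in> range \<tau> \<Longrightarrow> \<bar>column k (A t) \<bullet> column l (A t)\<bar> \<le> \<epsilon>"
proof -
  have "\<epsilon> < (norm (column k (A t)))\<^sup>2" for k
    using col[OF \<open>t \<in> I\<close>, of k] diag theta_pos
    by (meson less_le_trans less_imp_le power_mono)
  moreover have "real (card F + CARD('n)) / \<epsilon>\<^sup>2 \<le> 2 * real CARD('n) / \<epsilon>\<^sup>2"
    using assms(4) by (intro divide_right_mono) auto
  ultimately obtain T where T: "card T = CARD('n)" "T \<inter> F = {}" "near_orth \<epsilon> (A t) T"
      "\<forall>k\<in>F. \<forall>l\<in>T. \<bar>column k (A t) \<bullet> column l (A t)\<bar> \<le> \<epsilon>"
    using greedy_near_orth_columns[of "A t" \<epsilon> F "CARD('n)", OF contr[OF \<open>t \<in> I\<close>] eps_pos] size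
    by force
  obtain \<tau> :: "'n \<Rightarrow> 'k" where "bij_betw \<tau> UNIV T"
    using T(1) finite_same_card_bij[of "UNIV :: 'n set" T] by auto
  then have "inj \<tau>" "range \<tau> = T" by (auto simp: bij_betw_def)
  with T that show ?thesis by blast
qed

text \<open>The new choice \<tau> is made at time \<open>a\<close>, and \<open>R\<close> rotates
  from \<sigma> to it. Errors do not accumulate over many steps: \<tau> starts with tolerance
  \<epsilon> and arrives at \<open>b\<close> with \<open>2 * \<epsilon>\<close>, again a
  \<open>state\<close>.\<close>

lemma frame_path_short:
  fixes \<sigma> :: "'n::finite \<Rightarrow> 'k"
  assumes "a < b" and sub: "{a..b} \<subseteq> I" and st: "state a \<sigma>"
    and size: "2 * real CARD('n) / \<epsilon>\<^sup>2 < real CARD('k)"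
    and small: "8 * real CARD('n) * \<epsilon> \<le> \<theta>\<^sup>2"
    and drift: "\<And>t k l. t \<in> {a..b} \<Longrightarrow>
      \<bar>column k (A t) \<bullet> column l (A t) - column k (A a) \<bullet> column l (A a)\<bar> \<le> \<epsilon>"
  shows "\<exists>R \<tau>. frame_path a b \<sigma> R \<tau>"
proof -
  have "a \<in> I" using sub \<open>a < b\<close> by auto
  have "card (range \<sigma>) \<le> CARD('n)" by (rule card_image_le) simp
  have "8 * \<epsilon> \<le> 8 * real CARD('n) * \<epsilon>" using eps_pos by (simp add: Suc_leI)
  then have diag: "\<epsilon> < \<theta>\<^sup>2" using small eps_pos by linarith
  obtain \<tau> :: "'n \<Rightarrow> 'k" where \<tau>: "inj \<tau>" "range \<tau> \<inter> range \<sigma> = {}" "near_orth \<epsilon> (A a) (range \<tau>)"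
    "\<And>k l. k \<in> range \<sigma> \<Longrightarrow> l \<in> range \<tau> \<Longrightarrow> \<bar>column k (A a) \<bullet> column l (A a)\<bar> \<le> \<epsilon>"
    using state_exists[OF \<open>a \<in> I\<close> size diag \<open>card (range \<sigma>) \<le> CARD('n)\<close>] by metis
  define R where "R = (\<lambda>t. rotate_embed \<sigma> \<tau> ((t - a) / (b - a)))"
  have "near_orth (2 * \<epsilon>) (A b) (range \<tau>)"
    unfolding near_orth_def
  proof (intro ballI impI)
    fix k l assume "k \<in> range \<tau>" "l \<in> range \<tau>" "k \<noteq> l"
    then have "\<bar>column k (A a) \<bullet> column l (A a)\<bar> \<le> \<epsilon>" using \<tau>(3) by (auto simp: near_orth_def)
    then show "\<bar>column k (A b) \<bullet> column l (A b)\<bar> \<le> 2 * \<epsilon>"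
      using drift[of b k l] \<open>a < b\<close> by auto
  qed
  then have "state b \<tau>" using \<tau>(1) by (simp add: state_def)
  moreover have "continuous_on {a..b} R"
    unfolding R_def rotate_embed_def using \<open>a < b\<close> by (intro continuous_intros) auto
  moreover have "R a = coord_embed \<sigma>" "R b = coord_embed \<tau>"
    using \<open>a < b\<close> by (auto simp: R_def rotate_embed_def)
  moreover have "stable_frame (\<theta> / 2) (A t) (R t)" if t: "t \<in> {a..b}" for t
    unfolding R_def
  proof (rule stable_frameI[where \<eta> = "3 * \<epsilon>" and S = "range \<sigma> \<union> range \<tau>"])
    have inj: "inj \<sigma>" using st by (simp add: state_def)
    have disj: "range \<sigma> \<inter> range \<tau> = {}" using \<tau>(2) by blast
    have "0 \<le> (t - a) / (b - a)" "(t - a) / (b - a) \<le> 1"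
      using t \<open>a < b\<close> by (auto simp: divide_le_eq_1)
    then show "norm (rotate_embed \<sigma> \<tau> ((t - a) / (b - a)) *v x) = norm x" for x
      by (intro norm_rotate_embed_mult inj \<tau>(1) disj)
    \<comment> \<open>Two disjoint choices with tolerance \<open>3 * \<epsilon>\<close> give
      \<open>24 * CARD('n) * \<epsilon>\<close> on the left, so the condition is exactly three times
      \<open>small\<close>.\<close>
    have "card (range \<sigma> \<union> range \<tau>) = 2 * CARD('n)"
      using inj \<tau>(1) disj by (simp add: card_Un_disjoint card_image)
    then show "4 * real (card (range \<sigma> \<union> range \<tau>)) * (3 * \<epsilon>) \<le> 3 * \<theta>\<^sup>2"
      using small by (simp add: mult_ac)
    show "near_orth (3 * \<epsilon>) (A t) (range \<sigma> \<union> range \<tau>)"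
      unfolding near_orth_def
    proof (intro ballI impI)
      fix k l assume kl: "k \<in> range \<sigma> \<union> range \<tau>" "l \<in> range \<sigma> \<union> range \<tau>" "k \<noteq> l"
      \<comment> \<open>At time \<open>a\<close> only pairs of old columns need the tolerance
        \<open>2 * \<epsilon>\<close>; all other pairs meet \<epsilon>. The drift up to
        \<open>t\<close> then adds one more \<epsilon>.\<close>
      have "\<bar>column k (A a) \<bullet> column l (A a)\<bar> \<le> 2 * \<epsilon>"
      proof -
        consider "k \<in> range \<sigma>" "l \<in> range \<sigma>" | "k \<in> range \<sigma>" "l \<in> range \<tau>"
          | "k \<in> range \<tau>" "l \<in> range \<sigma>" | "k \<in> range \<tau>" "l \<in> range \<tau>"
          using kl by blast
        then show ?thesis
        proof cases
          case 1
          then show ?thesis using st kl(3) by (auto simp: state_def near_orth_def)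
        next
          case 2
          then show ?thesis using \<tau>(4)[of k l] eps_pos by linarith
        next
          case 3
          then show ?thesis using \<tau>(4)[of l k] eps_pos by (simp add: inner_commute)
        next
          case 4
          then have "\<bar>column k (A a) \<bullet> column l (A a)\<bar> \<le> \<epsilon>"
            using \<tau>(3) kl(3) unfolding near_orth_def by blast
          then show ?thesis using eps_pos by linarith
        qed
      qed
      then show "\<bar>column k (A t) \<bullet> column l (A t)\<bar> \<le> 3 * \<epsilon>"
        using drift[OF t, of k l] by linarith
    qed
    show "\<theta> \<le> norm (column k (A t))" for k using col sub t by auto
  qed (use eps_pos theta_pos in \<open>auto simp: rotate_embed_mult coord_embed_mult_outside\<close>)
  ultimately show ?thesis unfolding frame_path_def by blast
qed

text \<open>This provides the constant path on a one-point interval, where there is no room to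
  rotate.\<close>

lemma stable_frame_embed:
  fixes \<sigma> :: "'n::finite \<Rightarrow> 'k"
  assumes "t \<in> I" and st: "state t \<sigma>" and small: "8 * real CARD('n) * \<epsilon> \<le> \<theta>\<^sup>2"
  shows "stable_frame (\<theta> / 2) (A t) (coord_embed \<sigma>)"
proof (rule stable_frameI[where \<eta> = "2 * \<epsilon>" and S = "range \<sigma>"])
  have inj: "inj \<sigma>" using st by (simp add: state_def)
  show "norm (coord_embed \<sigma> *v x) = norm x" for x
    by (simp add: norm_eq_sqrt_inner coord_embed_inner_embed[OF inj])
  have "8 * real CARD('n) * \<epsilon> \<le> 3 * \<theta>\<^sup>2"
    using small zero_le_power2[of \<theta>] by linarith
  then show "4 * real (card (range \<sigma>)) * (2 * \<epsilon>) \<le> 3 * \<theta>\<^sup>2"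
    by (simp add: card_image inj)
qed (use st eps_pos theta_pos col[OF \<open>t \<in> I\<close>] in \<open>auto simp: state_def coord_embed_mult_outside\<close>)

text \<open>One \<open>d\<close> serves all pairs of columns because there are finitely many. The
  bound is half of \<epsilon> since two times near \<open>x\<close> will be compared through
  \<open>x\<close>.\<close>

lemma small_drift:
  assumes "x \<in> I"
  obtains d where "d > 0" "\<And>t k l. t \<in> I \<Longrightarrow> \<bar>t - x\<bar> < d \<Longrightarrow>
      \<bar>column k (A t) \<bullet> column l (A t) - column k (A x) \<bullet> column l (A x)\<bar> < \<epsilon> / 2"
proof -
  have "continuous_on I (\<lambda>t. column k (A t) \<bullet> column l (A t))" for k l
    unfolding column_def using cont by (intro continuous_intros) auto
  then have "((\<lambda>t. column k (A t) \<bullet> column l (A t)) \<longlongrightarrow>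
      column k (A x) \<bullet> column l (A x)) (at x within I)" for k l
    using assms by (simp add: continuous_on)
  then have "\<forall>\<^sub>F t in at x within I.
      dist (column k (A t) \<bullet> column l (A t)) (column k (A x) \<bullet> column l (A x)) < \<epsilon> / 2" for k l
    using eps_pos by (intro tendstoD) auto
  then have "\<forall>\<^sub>F t in at x within I. \<forall>k l.
      dist (column k (A t) \<bullet> column l (A t)) (column k (A x) \<bullet> column l (A x)) < \<epsilon> / 2"
    by (intro eventually_all_finite)
  then obtain d where d: "d > 0" "\<And>t k l. t \<in> I \<Longrightarrow> t \<noteq> x \<Longrightarrow> dist t x < d \<Longrightarrow>
      dist (column k (A t) \<bullet> column l (A t)) (column k (A x) \<bullet> column l (A x)) < \<epsilon> / 2"
    unfolding eventually_at by blast
  show ?thesis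
  proof
    fix t k l assume "t \<in> I" "\<bar>t - x\<bar> < d"
    then show "\<bar>column k (A t) \<bullet> column l (A t) - column k (A x) \<bullet> column l (A x)\<bar> < \<epsilon> / 2"
      using d(2)[of t k l] eps_pos by (cases "t = x") (auto simp: dist_real_def)
  qed (fact d(1))
qed

text \<open>Bisection in the form of \<open>Bolzano\<close>: existence of paths is preserved by
  concatenation and holds on all short intervals around a point.\<close>

lemma frame_path_exists:
  fixes \<sigma> :: "'n::finite \<Rightarrow> 'k"
  assumes "a \<le> b" and sub: "{a..b} \<subseteq> I" and st: "state a \<sigma>"
    and size: "2 * real CARD('n) / \<epsilon>\<^sup>2 < real CARD('k)"
    and small: "8 * real CARD('n) * \<epsilon> \<le> \<theta>\<^sup>2"
  shows "\<exists>R \<tau>. frame_path a b \<sigma> R \<tau>"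
proof -
  \<comment> \<open>All starting choices are quantified over, since the one at a joining point is
    not known beforehand. The inclusion in \<open>I\<close> is a premise inside \<open>P\<close>
    because short intervals around a point may leave \<open>I\<close>.\<close>
  define P where "P a b \<longleftrightarrow> {a..b} \<subseteq> I \<longrightarrow>
      (\<forall>\<sigma> :: 'n \<Rightarrow> 'k. state a \<sigma> \<longrightarrow> (\<exists>R \<tau>. frame_path a b \<sigma> R \<tau>))" for a b
  have "P a b"
    using \<open>a \<le> b\<close>
  proof (induction rule: Bolzano)
    case (trans a b c)
    show ?case unfolding P_def
    proof (intro impI allI)
      fix \<sigma> :: "'n \<Rightarrow> 'k" assume sub: "{a..c} \<subseteq> I" and "state a \<sigma>"
      then obtain R \<tau> where 1: "frame_path a b \<sigma> R \<tau>"
        using trans unfolding P_def by force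
      then obtain R' \<upsilon> where 2: "frame_path b c \<tau> R' \<upsilon>"
        using trans sub unfolding P_def frame_path_def by force
      show "\<exists>R \<tau>. frame_path a c \<sigma> R \<tau>"
        using frame_path_join[OF 1 2] trans by blast
    qed
  next
    case (local x)
    then have "x \<in> I" using sub by auto
    then obtain d where d: "d > 0" "\<And>t k l. t \<in> I \<Longrightarrow> \<bar>t - x\<bar> < d \<Longrightarrow>
      \<bar>column k (A t) \<bullet> column l (A t) - column k (A x) \<bullet> column l (A x)\<bar> < \<epsilon> / 2"
      using small_drift by metis
    have "P a b" if ab: "a \<le> x" "x \<le> b" "b - a < d" for a b
      unfolding P_def
    proof (intro impI allI)
      fix \<sigma> :: "'n \<Rightarrow> 'k" assume sub: "{a..b} \<subseteq> I" and st: "state a \<sigma>"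
      show "\<exists>R \<tau>. frame_path a b \<sigma> R \<tau>"
      proof (cases "a = b")
        case True
        then have "frame_path a b \<sigma> (\<lambda>_. coord_embed \<sigma>) \<sigma>"
          using st sub stable_frame_embed[OF _ st small] by (auto simp: frame_path_def)
        then show ?thesis by blast
      next
        case False
        show ?thesis
        proof (rule frame_path_short[OF _ _ st size small])
          fix t k l assume "t \<in> {a..b}"
          then have "t \<in> I" "\<bar>t - x\<bar> < d" "a \<in> I" "\<bar>a - x\<bar> < d" using sub ab by auto
          then show "\<bar>column k (A t) \<bullet> column l (A t) - column k (A a) \<bullet> column l (A a)\<bar> \<le> \<epsilon>"
            using d(2)[of t k l] d(2)[of a k l] by linarith
        qed (use ab False sub in auto)
      qed
    qed
    with d(1) show ?case by blast
  qed
  then show ?thesis using sub st by (simp add: P_def)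
qed

end

text \<open>The cases are a supremum that is attained, infinite, or finite but missing. The last
  property puts a whole neighbourhood of \<open>t\<close> in \<open>I\<close> below some
  \<open>s k\<close>, not just \<open>t\<close>, so that continuity at \<open>t\<close> can be read
  off from a compact interval.\<close>

lemma cofinal_sequence_in_interval:
  fixes I :: "real set"
  assumes int: "is_interval I" and "t\<^sub>0 \<in> I"
  obtains s :: "nat \<Rightarrow> real" where "s 0 = t\<^sub>0" "mono s" "range s \<subseteq> I"
    "\<And>t. t \<in> I \<Longrightarrow> \<exists>k. \<exists>e>0. \<forall>u\<in>I. u < t + e \<longrightarrow> u \<le> s k"
proof -
  have mem: "x \<in> I" if "y \<in> I" "t\<^sub>0 \<le> x" "x \<le> y" for x y
    using int that \<open>t\<^sub>0 \<in> I\<close> unfolding is_interval_1 by blast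
  consider (max) m where "m \<in> I" "\<forall>u\<in>I. u \<le> m"
    | (unbounded) "\<not> bdd_above I"
    | (bounded) "bdd_above I" "\<forall>m\<in>I. \<exists>u\<in>I. m < u"
    by (meson not_le)
  then show ?thesis
  proof cases
    case max
    show ?thesis
      by (rule that[of "\<lambda>k. if k = 0 then t\<^sub>0 else m"])
         (use max \<open>t\<^sub>0 \<in> I\<close> in \<open>auto simp: mono_def intro!: exI[of _ "1::nat"] exI[of _ "1::real"]\<close>)
  next
    case unbounded
    show ?thesis
    proof (rule that[of "\<lambda>k. t\<^sub>0 + real k"])
      have "t\<^sub>0 + real k \<in> I" for k
        using unbounded mem[of _ "t\<^sub>0 + real k"] unfolding bdd_above_def
        by (metis le_add_same_cancel1 linorder_le_cases of_nat_0_le_iff)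
      then show "range (\<lambda>k. t\<^sub>0 + real k) \<subseteq> I" by auto
      fix t
      obtain k :: nat where "t + 1 - t\<^sub>0 \<le> real k" using real_arch_simple by blast
      then show "\<exists>k. \<exists>e>0. \<forall>u\<in>I. u < t + e \<longrightarrow> u \<le> t\<^sub>0 + real k"
        by (intro exI[of _ k] exI[of _ 1]) auto
    qed (auto simp: mono_def)
  next
    case bounded
    define b where "b = Sup I"
    have lt: "u < b" if "u \<in> I" for u
      using bounded that cSup_upper unfolding b_def by (metis less_le_trans)
    have I: "x \<in> I" if "t\<^sub>0 \<le> x" "x < b" for x
      using that less_cSup_iff[of I x] bounded(1) \<open>t\<^sub>0 \<in> I\<close> mem[of _ x] unfolding b_def
      by (metis empty_iff less_imp_le)
    let ?s = "\<lambda>k. b - (b - t\<^sub>0) / (real k + 1)"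
    have pos: "b - t\<^sub>0 > 0" using lt[OF \<open>t\<^sub>0 \<in> I\<close>] by simp
    show ?thesis
    proof (rule that[of ?s])
      show "mono ?s"
        using pos by (auto simp: mono_def intro!: divide_left_mono)
      have "(b - t\<^sub>0) / (real k + 1) \<le> b - t\<^sub>0" "(b - t\<^sub>0) / (real k + 1) > 0" for k
        using pos by (simp_all add: divide_le_eq)
      then have "?s k \<in> I" for k
        by (intro I) (smt (verit))+
      then show "range ?s \<subseteq> I" by auto
      fix t assume "t \<in> I"
      \<comment> \<open>With half the distance to the supremum, \<open>t + e\<close> equals
        \<open>b - e\<close>, so it suffices that the gap between \<open>b\<close> and the sequence
        is at most \<open>e\<close>.\<close>
      define e where "e = (b - t) / 2"
      have e: "e > 0" using lt[OF \<open>t \<in> I\<close>] by (simp add: e_def)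
      obtain k :: nat where "(b - t\<^sub>0) / e \<le> real k" using real_arch_simple by blast
      then have "(b - t\<^sub>0) / e \<le> real k + 1" by simp
      then have "(b - t\<^sub>0) / (real k + 1) \<le> e" using e by (simp add: field_simps)
      moreover have "t + e = b - e" by (simp add: e_def field_simps)
      ultimately show "\<exists>k. \<exists>e>0. \<forall>u\<in>I. u < t + e \<longrightarrow> u \<le> ?s k"
        using e by (intro exI[of _ k] exI[of _ e]) auto
    qed simp
  qed
qed

section \<open>Frames on the whole interval\<close>

context contraction_family
begin

text \<open>Paths over the intervals \<open>{s k..s (Suc k)}\<close> are chained by dependent
  choice, each stage remembering its final choice of columns. Successive stages extend one another
  and so define one frame to the right of \<open>t\<^sub>0\<close>.\<close>

lemma stable_frame_right:
  fixes \<sigma> :: "'n::finite \<Rightarrow> 'k"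
  assumes t0: "t\<^sub>0 \<in> I" and st: "state t\<^sub>0 \<sigma>"
    and size: "2 * real CARD('n) / \<epsilon>\<^sup>2 < real CARD('k)"
    and small: "8 * real CARD('n) * \<epsilon> \<le> \<theta>\<^sup>2"
  shows "\<exists>R. continuous_on (I \<inter> {t\<^sub>0..}) R \<and> R t\<^sub>0 = coord_embed \<sigma> \<and>
           (\<forall>t\<in>I \<inter> {t\<^sub>0..}. stable_frame (\<theta> / 2) (A t) (R t))"
proof -
  obtain s :: "nat \<Rightarrow> real" where s: "s 0 = t\<^sub>0" "mono s" "range s \<subseteq> I"
    "\<And>t. t \<in> I \<Longrightarrow> \<exists>k. \<exists>e>0. \<forall>u\<in>I. u < t + e \<longrightarrow> u \<le> s k"
    using cofinal_sequence_in_interval[OF interval t0] by metis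
  have s_ge: "t\<^sub>0 \<le> s k" for k using s(1) monoD[OF s(2), of 0 k] by simp
  have sub: "{s k..s (Suc k)} \<subseteq> I" for k
    using s(3) interval unfolding is_interval_1 by (auto simp: subset_iff) (metis rangeI)
  define P where "P k p \<longleftrightarrow> frame_path t\<^sub>0 (s k) \<sigma> (fst p) (snd p)"
    for k and p :: "(real \<Rightarrow> real ^ 'n ^ 'k) \<times> ('n \<Rightarrow> 'k)"
  have "\<exists>f. \<forall>k. P k (f k) \<and> (\<forall>t\<le>s k. fst (f (Suc k)) t = fst (f k) t)"
  proof (rule dependent_nat_choice)
    have "P 0 (\<lambda>_. coord_embed \<sigma>, \<sigma>)"
      using st stable_frame_embed[OF t0 st small] by (auto simp: P_def frame_path_def s(1))
    then show "\<exists>p. P 0 p" by blast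
  next
    fix p k assume p: "P k p"
    then have 1: "frame_path t\<^sub>0 (s k) \<sigma> (fst p) (snd p)" by (simp add: P_def)
    have le: "s k \<le> s (Suc k)" using s(2) by (simp add: mono_iff_le_Suc)
    have "state (s k) (snd p)" using 1 by (simp add: frame_path_def)
    then obtain R \<tau> where 2: "frame_path (s k) (s (Suc k)) (snd p) R \<tau>"
      using frame_path_exists[OF le sub _ size small] by blast
    show "\<exists>q. P (Suc k) q \<and> (\<forall>t\<le>s k. fst q t = fst p t)"
      using frame_path_join[OF 1 2 s_ge le]
      by (intro exI[of _ "(\<lambda>t. if t \<le> s k then fst p t else R t, \<tau>)"]) (auto simp: P_def)
  qed
  then obtain f where f: "\<And>k. P k (f k)" "\<And>k t. t \<le> s k \<Longrightarrow> fst (f (Suc k)) t = fst (f k) t"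
    by blast
  have agree: "fst (f l) t = fst (f k) t" if "k \<le> l" "t \<le> s k" for k l t
    using that(1)
  proof (induction rule: dec_induct)
    case (step m)
    have "t \<le> s m" using monoD[OF s(2) step(1)] that(2) by simp
    then show ?case using f(2) step by simp
  qed simp
  \<comment> \<open>The first stage that reaches \<open>t\<close> supplies the value; by
    \<open>agree\<close> every later stage gives the same one.\<close>
  define R where "R t = fst (f (LEAST k. t \<le> s k)) t" for t
  have R: "R t = fst (f k) t" if "t \<le> s k" for k t
    unfolding R_def
    using agree[OF Least_le[of "\<lambda>k. t \<le> s k", OF that] LeastI[of "\<lambda>k. t \<le> s k", OF that]] by simp
  have path: "frame_path t\<^sub>0 (s k) \<sigma> R (snd (f k))" for k
  proof -
    have "frame_path t\<^sub>0 (s k) \<sigma> (fst (f k)) (snd (f k))" using f(1) by (simp add: P_def)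
    moreover have "continuous_on {t\<^sub>0..s k} R \<longleftrightarrow> continuous_on {t\<^sub>0..s k} (fst (f k))"
      by (rule continuous_on_cong) (auto simp: R)
    ultimately show ?thesis using s_ge[of k] by (simp add: frame_path_def R[of _ k])
  qed
  have "continuous (at t within I \<inter> {t\<^sub>0..}) R \<and> stable_frame (\<theta> / 2) (A t) (R t)"
    if t: "t \<in> I \<inter> {t\<^sub>0..}" for t
  proof -
    obtain k e where e: "e > 0" "\<forall>u\<in>I. u < t + e \<longrightarrow> u \<le> s k" using s(4) t by blast
    then have ts: "t \<in> {t\<^sub>0..s k}" using t by auto
    then have "stable_frame (\<theta> / 2) (A t) (R t)" "continuous (at t within {t\<^sub>0..s k}) R"
      using path[of k] by (auto simp: frame_path_def continuous_on_eq_continuous_within)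
    moreover have "continuous (at t within (I \<inter> {t\<^sub>0..}) \<inter> {..<t + e}) R"
      by (rule continuous_within_subset[OF calculation(2)]) (use e in auto)
    moreover have "at t within (I \<inter> {t\<^sub>0..}) \<inter> {..<t + e} = at t within I \<inter> {t\<^sub>0..}"
      using e(1) by (intro at_within_nhd[of _ "{..<t + e}"]) auto
    ultimately show ?thesis by simp
  qed
  moreover have "R t\<^sub>0 = coord_embed \<sigma>" using path[of 0] by (simp add: frame_path_def)
  ultimately show ?thesis by (auto simp: continuous_on_eq_continuous_within)
qed

text \<open>From a starting point \<open>t\<^sub>0\<close> the frame is built in both directions,
  leftwards by applying the one-sided result to the reflected family. The halves fit because both
  equal \<open>coord_embed \<sigma>\<close> at \<open>t\<^sub>0\<close>.\<close>

lemma stable_frame_exists: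
  assumes size: "2 * real CARD('n::finite) / \<epsilon>\<^sup>2 < real CARD('k)"
    and small: "8 * real CARD('n::finite) * \<epsilon> \<le> \<theta>\<^sup>2"
  shows "\<exists>R :: real \<Rightarrow> real ^ 'n::finite ^ 'k.
           continuous_on I R \<and> (\<forall>t\<in>I. stable_frame (\<theta> / 2) (A t) (R t))"
proof (cases "I = {}")
  case False
  then obtain t\<^sub>0 where t0: "t\<^sub>0 \<in> I" by blast
  have "8 * \<epsilon> \<le> 8 * real CARD('n) * \<epsilon>" using eps_pos by (simp add: Suc_leI)
  then have diag: "\<epsilon> < \<theta>\<^sup>2" using small eps_pos by linarith
  obtain \<sigma> :: "'n \<Rightarrow> 'k" where \<sigma>: "inj \<sigma>" "near_orth \<epsilon> (A t\<^sub>0) (range \<sigma>)"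
    using state_exists[OF t0 size diag, of "{}"] by auto
  then have st: "state t\<^sub>0 \<sigma>" using eps_pos by (force simp: state_def near_orth_def)
  interpret reflected: contraction_family "uminus ` I" "\<lambda>t. A (- t)" \<theta> \<epsilon>
  proof
    show "continuous_on (uminus ` I) (\<lambda>t. A (- t))"
      by (rule continuous_on_compose2[OF cont]) (auto intro!: continuous_intros)
  qed (use interval contr col theta_pos eps_pos in auto)
  have st': "reflected.state (- t\<^sub>0) \<sigma>"
    using st by (simp add: state_def reflected.state_def)
  obtain R where R: "continuous_on (I \<inter> {t\<^sub>0..}) R" "R t\<^sub>0 = coord_embed \<sigma>"
      "\<forall>t\<in>I \<inter> {t\<^sub>0..}. stable_frame (\<theta> / 2) (A t) (R t)"
    using stable_frame_right[OF t0 st size small] by blast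
  obtain R' where R': "continuous_on (uminus ` I \<inter> {- t\<^sub>0..}) R'" "R' (- t\<^sub>0) = coord_embed \<sigma>"
      "\<forall>t\<in>uminus ` I \<inter> {- t\<^sub>0..}. stable_frame (\<theta> / 2) (A (- t)) (R' t)"
    using reflected.stable_frame_right[OF _ st' size small] t0 by blast
  define Q where "Q t = (if t \<in> {..t\<^sub>0} then R' (- t) else R t)" for t
  have "continuous_on (I \<inter> {..t\<^sub>0}) (\<lambda>t. R' (- t))"
    by (rule continuous_on_compose2[OF R'(1)]) (auto intro!: continuous_intros)
  then have "continuous_on (I \<inter> {..t\<^sub>0} \<union> I \<inter> {t\<^sub>0..}) Q"
    unfolding Q_def
    by (intro continuous_on_cases_local R(1))
       (use R(2) R'(2) in \<open>auto simp: closedin_closed_Int closedin_closed\<close>)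
  moreover have "I \<inter> {..t\<^sub>0} \<union> I \<inter> {t\<^sub>0..} = I" by auto
  moreover have "stable_frame (\<theta> / 2) (A t) (Q t)" if "t \<in> I" for t
    using that R(3) R'(3)[rule_format, of "- t"] by (auto simp: Q_def)
  ultimately show ?thesis by auto
qed auto

end


section \<open>Continuous left inverses\<close>

lemma continuous_on_det:
  fixes M :: "'a::topological_space \<Rightarrow> real ^ 'n ^ 'n"
  assumes "\<And>i j. continuous_on S (\<lambda>t. M t $ i $ j)"
  shows "continuous_on S (\<lambda>t. det (M t))"
  unfolding det_def
  by (intro continuous_on_sum continuous_on_mult continuous_on_prod continuous_on_const assms)

text \<open>The left inverse is the Moore--Penrose one; Cramer's rule makes it visibly continuous.\<close>

lemma continuous_left_inverse:
  fixes B :: "'a::topological_space \<Rightarrow> real ^ 'n ^ 'm"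
  assumes cont: "continuous_on S B" and "c > 0"
    and below: "\<And>t x. t \<in> S \<Longrightarrow> c * norm x \<le> norm (B t *v x)"
  shows "\<exists>L. continuous_on S L \<and>
           (\<forall>t\<in>S. L t ** B t = mat 1 \<and> (\<forall>v. norm (L t *v v) \<le> norm v / c))"
proof -
  define M where "M t = transpose (B t) ** B t" for t
  \<comment> \<open>By Cramer's rule, column \<open>m\<close> of \<open>L t\<close> solves the
    system with matrix \<open>M t\<close> and right-hand side \<open>B t $ m\<close>, the
    \<open>m\<close>-th column of \<open>transpose (B t)\<close>. Where \<open>M t\<close> is
    invertible, \<open>L t\<close> is thus its inverse times \<open>transpose (B t)\<close>.\<close>
  define L where "L t = (\<chi> k m. det (\<chi> i j. if j = k then B t $ m $ i else M t $ i $ j) / det (M t))"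
    for t
  have contB: "continuous_on S (\<lambda>t. B t $ i $ j)" for i j
    using cont by (intro continuous_intros)
  have contM: "continuous_on S (\<lambda>t. M t $ i $ j)" for i j
    unfolding M_def matrix_matrix_mult_def transpose_def by (simp, intro continuous_intros contB)
  have xM: "x \<bullet> (M t *v x) = (norm (B t *v x))\<^sup>2" for t x
    by (simp add: M_def power2_norm_eq_inner dot_lmul_matrix vector_transpose_matrix inner_commute
        flip: matrix_vector_mul_assoc)
       (simp add: dot_lmul_matrix flip: vector_transpose_matrix)
  have ker: "x = 0" if "t \<in> S" "M t *v x = 0" for t x
  proof -
    have "norm (B t *v x) = 0" using xM[of x t] that by simp
    then show ?thesis using below[OF that(1), of x] \<open>c > 0\<close>
      by (metis linorder_not_le mult_pos_pos zero_less_norm_iff)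
  qed
  have det: "det (M t) \<noteq> 0" if "t \<in> S" for t
    using ker[OF that] by (metis invertible_det_nz invertible_left_inverse matrix_left_invertible_ker)
  have normal_eq: "M t ** L t = transpose (B t)" if "t \<in> S" for t
  proof -
    have "M t *v column m (L t) = B t $ m" for m
      using cramer[OF det[OF that], of "column m (L t)" "B t $ m"]
      by (simp add: L_def column_def)
    then show ?thesis
      by (simp add: vec_eq_iff matrix_matrix_mult_def matrix_vector_mult_def column_def transpose_def)
  qed
  have "continuous_on S L"
    unfolding L_def
  proof (intro continuous_on_vec_lambda continuous_on_divide continuous_on_det)
    show "continuous_on S (\<lambda>t. (\<chi> i j. if j = k then B t $ m $ i else M t $ i $ j) $ i $ j)" for k m i j
      by (cases "j = k") (simp_all add: contM contB)
  qed (use det contM in auto)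
  moreover have "L t ** B t = mat 1" if "t \<in> S" for t
  proof -
    have "M t ** (L t ** B t) = M t" using normal_eq[OF that] by (simp add: matrix_mul_assoc M_def)
    then have "M t *v ((L t ** B t) *v x - x) = 0" for x
      by (simp add: matrix_vector_mult_diff_distrib matrix_vector_mul_assoc)
    then have "(L t ** B t) *v x = x" for x using ker[OF that] by fastforce
    then show ?thesis by (simp add: matrix_eq)
  qed
  moreover have "norm (L t *v v) \<le> norm v / c" if "t \<in> S" for t v
  proof -
    let ?x = "L t *v v"
    \<comment> \<open>By the normal equations \<open>B t *v ?x\<close> is the orthogonal projection
      of \<open>v\<close> onto the range of \<open>B t\<close>, hence no longer than
      \<open>v\<close>; \<open>below\<close> then costs the factor \<open>1 / c\<close>.\<close>
    have "M t *v ?x = transpose (B t) *v v" using normal_eq[OF that] by (simp add: matrix_vector_mul_assoc)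
    then have "(norm (B t *v ?x))\<^sup>2 = ?x \<bullet> (transpose (B t) *v v)" using xM[of ?x t] by simp
    also have "\<dots> = v \<bullet> (B t *v ?x)"
      by (metis dot_lmul_matrix inner_commute transpose_matrix_vector)
    also have "\<dots> \<le> norm v * norm (B t *v ?x)" by (rule norm_cauchy_schwarz)
    finally have "norm (B t *v ?x) \<le> norm v"
      by (metis linorder_not_le mult_right_le_imp_le norm_ge_zero order_le_less power2_eq_square)
    then show ?thesis using below[OF that, of ?x] \<open>c > 0\<close> by (simp add: field_simps)
  qed
  ultimately show ?thesis by blast
qed

section \<open>Choice of the tolerance and assembly\<close>

theorem theorem3p9:
  fixes I :: "real set"
    and A :: "real \<Rightarrow> real ^ 'N ^ 'N"
    and \<theta> :: real
  assumes "is_interval I"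
    and "continuous_on I A"
    and "\<forall>t\<in>I. onorm (\<lambda>x. A t *v x) \<le> 1"
    and "\<theta> = (INF t\<in>I. MIN i. norm (column i (A t)))"
    and "\<theta> > 0"
    and "real CARD('n) \<le> 1 / 12 * \<theta> powr (4 / 3) * real CARD('N) powr (1 / 3)"
  shows "\<exists>(L :: real \<Rightarrow> real ^ 'N ^ 'n) (R :: real \<Rightarrow> real ^ 'n ^ 'N).
           continuous_on I L \<and> continuous_on I R \<and>
           (\<forall>t\<in>I. L t ** A t ** R t = mat 1 \<and>
                  onorm (\<lambda>x. L t *v x) * onorm (\<lambda>x. R t *v x) \<le> 2 / \<theta>)"
proof -
  let ?n = "real CARD('n)" and ?N = "real CARD('N)"
  \<comment> \<open>This turns the condition
    \<open>8 * ?n * \<epsilon> \<le> \<theta>\<^sup>2\<close> into an equality.\<close>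
  define \<epsilon> where "\<epsilon> = \<theta>\<^sup>2 / (8 * ?n)"
  have n: "?n > 0" by simp
  \<comment> \<open>Cubing clears the fractional exponents:
    \<open>1728 * ?n ^ 3 \<le> \<theta> ^ 4 * ?N\<close>, where 1728 is the cube of 12. For this
    \<epsilon>, \<open>size\<close> asks for the strict inequality with 128 instead.\<close>
  have "?n ^ 3 \<le> (1 / 12 * \<theta> powr (4 / 3) * ?N powr (1 / 3)) ^ 3"
    using assms(6) by (intro power_mono) auto
  also have "\<dots> = \<theta> ^ 4 * ?N / 1728"
    using \<open>\<theta> > 0\<close> by (simp add: power_mult_distrib powr_power power_divide powr_powr flip: powr_numeral)
  finally have "128 * ?n ^ 3 < \<theta> ^ 4 * ?N" using zero_less_power[OF n, of 3] by linarith
  moreover have "2 * ?n / \<epsilon>\<^sup>2 = 128 * ?n ^ 3 / \<theta> ^ 4"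
    using n \<open>\<theta> > 0\<close> by (simp add: \<epsilon>_def power_divide power_mult_distrib)
      (simp add: field_simps power2_eq_square power3_eq_cube power4_eq_xxxx)
  ultimately have size: "2 * ?n / \<epsilon>\<^sup>2 < ?N"
    using \<open>\<theta> > 0\<close> by (simp add: divide_less_eq mult.commute)
  interpret contraction_family I A \<theta> \<epsilon>
  proof
    show "norm (A t *v x) \<le> norm x" if "t \<in> I" for t x
      using onorm[OF matrix_vector_mul_bounded_linear[of "A t"], of x] assms(3) that
        mult_right_mono[of "onorm ((*v) (A t))" 1 "norm x"] by fastforce
    show "\<theta> \<le> norm (column k (A t))" if "t \<in> I" for t k
    proof -
      have "\<theta> \<le> (MIN i. norm (column i (A t)))"
        unfolding assms(4) using that
        by (intro cINF_lower bdd_belowI2[where m = 0]) auto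
      also have "\<dots> \<le> norm (column k (A t))" by (rule Min_le) auto
      finally show ?thesis .
    qed
    show "\<epsilon> > 0" using \<open>\<theta> > 0\<close> by (simp add: \<epsilon>_def)
  qed (use assms in auto)
  obtain R :: "real \<Rightarrow> real ^ 'n ^ 'N" where R: "continuous_on I R"
      "\<And>t. t \<in> I \<Longrightarrow> stable_frame (\<theta> / 2) (A t) (R t)"
    using stable_frame_exists[OF size] by (auto simp: \<epsilon>_def)
  have "continuous_on I (\<lambda>t. A t ** R t)"
    unfolding matrix_matrix_mult_def using R(1) assms(2) by (intro continuous_intros) auto
  then obtain L where L: "continuous_on I L" "\<And>t. t \<in> I \<Longrightarrow> L t ** (A t ** R t) = mat 1"
      "\<And>t v. t \<in> I \<Longrightarrow> norm (L t *v v) \<le> norm v / (\<theta> / 2)"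
    using continuous_left_inverse[of I "\<lambda>t. A t ** R t" "\<theta> / 2"] R(2) \<open>\<theta> > 0\<close>
    unfolding stable_frame_def matrix_vector_mul_assoc by fastforce
  have "onorm (\<lambda>x. L t *v x) * onorm (\<lambda>x. R t *v x) \<le> 2 / \<theta>" if "t \<in> I" for t
  proof -
    have "onorm (\<lambda>x. L t *v x) \<le> 2 / \<theta>"
      using L(3)[OF that] \<open>\<theta> > 0\<close> by (intro onorm_bound) (auto simp: mult.commute)
    moreover have "onorm (\<lambda>x. R t *v x) \<le> 1"
      using R(2)[OF that] by (intro onorm_bound) (auto simp: stable_frame_def)
    ultimately show ?thesis
      using mult_mono[of "onorm (\<lambda>x. L t *v x)" "2 / \<theta>" "onorm (\<lambda>x. R t *v x)" 1] \<open>\<theta> > 0\<close>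
      by (simp add: onorm_pos_le matrix_vector_mul_bounded_linear)
  qed
  with R(1) L(1,2) show ?thesis by (auto simp: matrix_mul_assoc)
qed

end
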